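(* (Domination) Let $G\in\mathbb{GS}$ and suppose $A,B$ are distinct Left options of $G$ with $A\preccurlyeq B$. Let $H=\langle G^{\mathcal L}\setminus\{A\}\mid G^{\mathcal R}\rangle$. Then $H\in\mathbb{GS}$ and $G\sim H$.
   Context: A scoring game is written $G=\langle G^{\mathcal L}\mid G^{\mathcal R}\rangle$, where each of $G^{\mathcal L}$ (Left options) and $G^{\mathcal R}$ (Right options) is either a finite nonempty set of scoring games or an atom $\emptyset^{s}$, $s\in\mathbb R$ (the player to move on that side cannot move and the game ends with score $s$); game trees are finite. An atom occurring in $G$ is an atom of $G$ or of any follower of $G$. $G$ is guaranteed if for every follower $K$ of $G$: if $K^{\mathcal L}=\emptyset^\ell$ then $\ell\le s$ for every atom $\emptyset^s$ occurring in $K$, and if $K^{\mathcal R}=\emptyset^r$ then $s\le r$ for every atom $\emptyset^s$ occurring in $K$; $\mathbb{GS}$ is the class of guaranteed games. Disjunctive sum $G+H$: Left options are $G^L+H$ and $G+H^L$, except if both are left-atomic with atoms $\emptyset^{\ell_1},\emptyset^{\ell_2}$, then $(G+H)^{\mathcal L}=\emptyset^{\ell_1+\ell_2}$; Right symmetric. Stops: $Ls(G)=\ell$ if $G^{\mathcal L}=\emptyset^\ell$, otherwise $\max_{G^L}Rs(G^L)$; $Rs(G)=r$ if $G^{\mathcal R}=\emptyset^r$, otherwise $\min_{G^R}Ls(G^R)$. $G\succcurlyeq H$ iff $Ls(G+X)\ge Ls(H+X)$ and $Rs(G+X)\ge Rs(H+X)$ for all $X\in\mathbb{GS}$; $A\preccurlyeq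 B$ means $B\succcurlyeq A$; $G\sim H$ iff $G\succcurlyeq H$ and $H\succcurlyeq G$. *)

theory Defs
  imports Complex_Main "HOL-Library.FSet"
begin

(* The datatype also contains trees with an empty option set (as opposed to an atom);
   these are excluded by scoring_game below. *)
datatype game = Game (left_side: side) (right_side: side)
  and side = Atom real | Options "game fset"

fun side_opts :: "side \<Rightarrow> game fset" where
  "side_opts (Atom s) = {||}"
| "side_opts (Options F) = F"

abbreviation left_opts :: "game \<Rightarrow> game fset" where
  "left_opts G \<equiv> side_opts (left_side G)"

abbreviation right_opts :: "game \<Rightarrow> game fset" where
  "right_opts G \<equiv> side_opts (right_side G)"

definition is_option :: "game \<Rightarrow> game \<Rightarrow> bool" where
  "is_option K G \<longleftrightarrow> K |\<in>| left_opts G \<or> K |\<in>| right_opts G"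

(* Every game counts as a follower of itself. *)
definition follower :: "game \<Rightarrow> game \<Rightarrow> bool" where
  "follower = is_option\<^sup>*\<^sup>*"

definition scoring_game :: "game \<Rightarrow> bool" where
  "scoring_game G \<longleftrightarrow>
     (\<forall>K. follower K G \<longrightarrow> left_side K \<noteq> Options {||} \<and> right_side K \<noteq> Options {||})"

definition atom_occurs :: "real \<Rightarrow> game \<Rightarrow> bool" where
  "atom_occurs s G \<longleftrightarrow>
     (\<exists>K. follower K G \<and> (left_side K = Atom s \<or> right_side K = Atom s))"

definition guaranteed :: "game \<Rightarrow> bool" where
  "guaranteed G \<longleftrightarrow>
     (\<forall>K. follower K G \<longrightarrow>
        (\<forall>l. left_side K = Atom l \<longrightarrow> (\<forall>s. atom_occurs s K \<longrightarrow> l \<le> s)) \<and>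
        (\<forall>r. right_side K = Atom r \<longrightarrow> (\<forall>s. atom_occurs s K \<longrightarrow> s \<le> r)))"

definition GS :: "game set" where
  "GS = {G. scoring_game G \<and> guaranteed G}"

lemma size_side_opts: "K |\<in>| side_opts S \<Longrightarrow> size K < size S"
  by (cases S) (auto simp: size_fset_overloaded_simps size_fset_simps less_Suc_eq_le
      intro!: member_le_sum[where f = "\<lambda>x. Suc (size x)", THEN Suc_leD])

lemma size_left_side: "size (left_side G) < size G"
  by (cases G) simp

lemma size_right_side: "size (right_side G) < size G"
  by (cases G) simp

lemma size_left_opts: "K |\<in>| left_opts G \<Longrightarrow> size K < size G"
  using size_side_opts size_left_side less_trans by blast

lemma size_right_opts: "K |\<in>| right_opts G \<Longrightarrow> size K < size G"
  using size_side_opts size_right_side less_trans by blast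

(* When exactly one summand is atomic on a side, that summand contributes no options there. *)
function game_sum :: "game \<Rightarrow> game \<Rightarrow> game"  (infixl "\<oplus>" 65) where
  "G \<oplus> H = Game
     (case (left_side G, left_side H) of
        (Atom l\<^sub>1, Atom l\<^sub>2) \<Rightarrow> Atom (l\<^sub>1 + l\<^sub>2)
      | _ \<Rightarrow> Options ((\<lambda>K. K \<oplus> H) |`| left_opts G |\<union>| (\<lambda>K. G \<oplus> K) |`| left_opts H))
     (case (right_side G, right_side H) of
        (Atom r\<^sub>1, Atom r\<^sub>2) \<Rightarrow> Atom (r\<^sub>1 + r\<^sub>2)
      | _ \<Rightarrow> Options ((\<lambda>K. K \<oplus> H) |`| right_opts G |\<union>| (\<lambda>K. G \<oplus> K) |`| right_opts H))"
  by pat_completeness auto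
termination
  by (relation "measure (\<lambda>(G, H). size G + size H)")
    (auto dest: size_left_opts size_right_opts)

declare game_sum.simps [simp del]

function Ls :: "game \<Rightarrow> real" and Rs :: "game \<Rightarrow> real" where
  "Ls G = (case left_side G of Atom l \<Rightarrow> l | Options F \<Rightarrow> Max (Rs ` fset F))"
| "Rs G = (case right_side G of Atom r \<Rightarrow> r | Options F \<Rightarrow> Min (Ls ` fset F))"
  by pat_completeness auto
termination
proof (relation "measure (\<lambda>x. case x of Inl G \<Rightarrow> size G | Inr G \<Rightarrow> size G)", goal_cases)
  case 1
  show ?case by simp
next
  case (2 G F K)
  then show ?case using size_left_opts[of K G] by simp
next
  case (3 G F K)
  then show ?case using size_right_opts[of K G] by simp
qed

declare Ls.simps [simp del] Rs.simps [simp del]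

definition game_ge :: "game \<Rightarrow> game \<Rightarrow> bool"  (infix "\<succcurlyeq>" 50) where
  "G \<succcurlyeq> H \<longleftrightarrow> (\<forall>X\<in>GS. Ls (G \<oplus> X) \<ge> Ls (H \<oplus> X) \<and> Rs (G \<oplus> X) \<ge> Rs (H \<oplus> X))"

abbreviation game_le :: "game \<Rightarrow> game \<Rightarrow> bool"  (infix "\<preccurlyeq>" 50) where
  "A \<preccurlyeq> B \<equiv> B \<succcurlyeq> A"

definition game_equiv :: "game \<Rightarrow> game \<Rightarrow> bool"  (infix "\<sim>" 50) where
  "G \<sim> H \<longleftrightarrow> G \<succcurlyeq> H \<and> H \<succcurlyeq> G"

end

theory Submission
  imports Defs
begin

text \<open>
  Induction on the test game \<open>X\<close> gives \<open>Ls (G \<oplus> X) = Ls (H \<oplus> X)\<close> and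
  \<open>Rs (G \<oplus> X) = Rs (H \<oplus> X)\<close>. Options obtained by moving in \<open>X\<close> agree by the induction hypothesis,
  and the additional Left option \<open>A \<oplus> X\<close> does not affect the maximum, since \<open>B \<oplus> X\<close> has at least
  the same Right stop.
\<close>

lemma follower_refl: "follower G G"
  by (simp add: follower_def)

lemma follower_option: "follower K L \<Longrightarrow> is_option L G \<Longrightarrow> follower K G"
  by (simp add: follower_def)

lemma follower_cases:
  assumes "follower K G"
  obtains "K = G" | L where "is_option L G" "follower K L"
  using assms unfolding follower_def by (metis rtranclp.cases)

lemma GS_option: "G \<in> GS \<Longrightarrow> is_option K G \<Longrightarrow> K \<in> GS"
  unfolding GS_def scoring_game_def guaranteed_def by (auto dest: follower_option)

text \<open>Below the root, only followers of \<open>G\<close> remain. The root itself can carry an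
  atom only on its Right side, which is that of \<open>G\<close>, so no new atom arises;
  \<open>F\<close> being nonempty keeps the root a legal scoring game.\<close>

lemma GS_restrict_left_opts:
  assumes "G \<in> GS" and "F |\<subseteq>| left_opts G" and "F \<noteq> {||}"
  shows "Game (Options F) (right_side G) \<in> GS"
proof -
  let ?H = "Game (Options F) (right_side G)"
  have opt: "is_option L G" if "is_option L ?H" for L
    using that assms(2) by (auto simp: is_option_def)
  have fol: "K = ?H \<or> follower K G" if "follower K ?H" for K
    using that by (cases rule: follower_cases) (auto dest: opt intro: follower_option)
  have occ: "atom_occurs s G" if at: "atom_occurs s ?H" for s
  proof -
    obtain K where K: "follower K ?H" "left_side K = Atom s \<or> right_side K = Atom s"
      using at unfolding atom_occurs_def by blast
    from fol[OF K(1)] show ?thesis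
    proof
      assume "K = ?H"
      then have "right_side G = Atom s"
        using K(2) by simp
      then show ?thesis
        using follower_refl[of G] unfolding atom_occurs_def by blast
    next
      assume "follower K G"
      then show ?thesis
        using K(2) unfolding atom_occurs_def by blast
    qed
  qed
  have sc: "scoring_game G" and gu: "guaranteed G"
    using assms(1) by (auto simp: GS_def)
  have "scoring_game ?H"
    unfolding scoring_game_def
  proof (intro allI impI)
    fix K
    assume "follower K ?H"
    from fol[OF this] show "left_side K \<noteq> Options {||} \<and> right_side K \<noteq> Options {||}"
    proof
      assume "K = ?H"
      then show ?thesis
        using sc follower_refl[of G] assms(3) by (simp add: scoring_game_def)
    qed (use sc in \<open>simp add: scoring_game_def\<close>)
  qed
  moreover have "guaranteed ?H"
    unfolding guaranteed_def
  proof (intro allI impI)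
    fix K
    assume "follower K ?H"
    from fol[OF this]
    show "(\<forall>l. left_side K = Atom l \<longrightarrow> (\<forall>s. atom_occurs s K \<longrightarrow> l \<le> s)) \<and>
      (\<forall>r. right_side K = Atom r \<longrightarrow> (\<forall>s. atom_occurs s K \<longrightarrow> s \<le> r))"
    proof
      \<comment> \<open>At the root the Left clause is vacuous, and the Right clause is inherited
        from \<open>G\<close> because \<open>occ\<close> places every atom of \<open>?H\<close> in
        \<open>G\<close>.\<close>
      assume "K = ?H"
      then show ?thesis
        using gu follower_refl[of G] occ by (simp add: guaranteed_def)
    qed (use gu in \<open>simp add: guaranteed_def\<close>)
  qed
  ultimately show ?thesis
    by (simp add: GS_def)
qed

text \<open>A sum is left-atomic only if both summands are. An atomic left side of \<open>X\<close>
  needs no separate case: \<open>left_opts X\<close> is then empty and the second image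
  vanishes.\<close>

lemma Ls_sum_Options:
  assumes "left_side G = Options F"
  shows "Ls (G \<oplus> X) =
    Max ((\<lambda>K. Rs (K \<oplus> X)) ` fset F \<union> (\<lambda>K. Rs (G \<oplus> K)) ` fset (left_opts X))"
  by (subst game_sum.simps)
    (simp add: assms Ls.simps image_Un image_image split: side.splits)

text \<open>Right moves in the first summand lead to the same games on both sides, so only the moves
  in \<open>X\<close> have to be compared.\<close>

lemma Rs_sum_cong:
  assumes "right_side G = right_side H"
    and "\<And>K. K |\<in>| right_opts X \<Longrightarrow> Ls (G \<oplus> K) = Ls (H \<oplus> K)"
  shows "Rs (G \<oplus> X) = Rs (H \<oplus> X)"
proof -
  have "(\<lambda>K. Ls (G \<oplus> K)) ` fset (right_opts X) = (\<lambda>K. Ls (H \<oplus> K)) ` fset (right_opts X)"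
    using assms(2) by (intro image_cong) auto
  then show ?thesis
    by (subst (1 2) game_sum.simps)
      (auto simp: assms(1) Rs.simps image_Un image_image split: side.splits)
qed

lemma Max_insert_dominated:
  assumes "finite S" and "b \<in> S" and "a \<le> b"
  shows "Max (insert a S) = Max S"
proof -
  have "a \<le> Max S"
    using assms by (meson Max_ge order_trans)
  then show ?thesis
    using assms(1,2) by (metis Max_insert empty_iff max_absorb2)
qed

lemma stops_remove_dominated:
  assumes G: "left_side G = Options F" and A: "A |\<in>| F" and B: "B |\<in>| F" and "A \<noteq> B"
    and "A \<preccurlyeq> B"
    and H: "H = Game (Options (F |-| {|A|})) (right_side G)"
    and "X \<in> GS"
  shows "Ls (G \<oplus> X) = Ls (H \<oplus> X) \<and> Rs (G \<oplus> X) = Rs (H \<oplus> X)"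
  using \<open>X \<in> GS\<close>
proof (induction "size X" arbitrary: X rule: less_induct)
  case less
  have L: "Rs (G \<oplus> K) = Rs (H \<oplus> K)" if "K |\<in>| left_opts X" for K
    using less.hyps[OF size_left_opts[OF that]] GS_option[OF less.prems, of K] that
    by (simp add: is_option_def)
  have R: "Ls (G \<oplus> K) = Ls (H \<oplus> K)" if "K |\<in>| right_opts X" for K
    using less.hyps[OF size_right_opts[OF that]] GS_option[OF less.prems, of K] that
    by (simp add: is_option_def)
  let ?T = "(\<lambda>K. Rs (H \<oplus> K)) ` fset (left_opts X)"
  let ?S = "(\<lambda>K. Rs (K \<oplus> X)) ` (fset F - {A}) \<union> ?T"
  have F: "fset F = insert A (fset F - {A})"
    using A by blast
  have "(\<lambda>K. Rs (G \<oplus> K)) ` fset (left_opts X) = ?T"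
    using L by (intro image_cong) auto
  then have "Ls (G \<oplus> X) = Max ((\<lambda>K. Rs (K \<oplus> X)) ` fset F \<union> ?T)"
    by (simp add: Ls_sum_Options[OF G])
  also have "\<dots> = Max (insert (Rs (A \<oplus> X)) ?S)"
    by (subst F) (simp only: image_insert Un_insert_left)
  \<comment> \<open>As \<open>B\<close> differs from \<open>A\<close>, the value
    \<open>Rs (B \<oplus> X)\<close> still lies in \<open>?S\<close>; domination tested at
    \<open>X\<close> itself bounds \<open>Rs (A \<oplus> X)\<close> by it.\<close>
  also have "\<dots> = Max ?S"
    using \<open>A \<preccurlyeq> B\<close> B \<open>A \<noteq> B\<close> less.prems
    by (intro Max_insert_dominated[of _ "Rs (B \<oplus> X)"]) (auto simp: game_ge_def)
  also have "\<dots> = Ls (H \<oplus> X)"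
    by (subst Ls_sum_Options[of H "F |-| {|A|}"]) (simp_all add: H)
  finally show ?case
    using Rs_sum_cong[of G H X] R by (simp add: H)
qed

theorem theorem28:
  fixes G A B H :: game
  assumes "G \<in> GS"
    and "A |\<in>| left_opts G" and "B |\<in>| left_opts G" and "A \<noteq> B"
    and "A \<preccurlyeq> B"
    and "H = Game (Options (left_opts G |-| {|A|})) (right_side G)"
  shows "H \<in> GS \<and> G \<sim> H"
proof
  have "B |\<in>| left_opts G |-| {|A|}"
    using assms(3,4) by auto
  then have "left_opts G |-| {|A|} \<noteq> {||}"
    by auto
  then show "H \<in> GS"
    unfolding assms(6) by (intro GS_restrict_left_opts assms(1)) auto
  \<comment> \<open>An atomic left side would make \<open>left_opts G\<close> empty, but
    \<open>A\<close> belongs to it.\<close>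
  have "left_side G = Options (left_opts G)"
    using assms(2) by (cases "left_side G") auto
  from stops_remove_dominated[OF this assms(2-6)] show "G \<sim> H"
    by (simp add: game_equiv_def game_ge_def)
qed

end
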